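(* Let $\{\mu_{nk}:n\in\mathbb{N},1\le k\le k_n\}\subset\mathcal{M}_{\mathbb{T}}^{\times}$ be an infinitesimal array and let $\{\lambda_n\}_{n=1}^\infty$ be a sequence in $\mathbb{T}$. If the sequence of measures $$\delta_{\lambda_n}\uplus_\times\mu_{n1}\uplus_\times\mu_{n2}\uplus_\times\cdots\uplus_\times\mu_{nk_n}$$ converges weakly on $\mathbb{T}$ to a probability measure $\nu$ as $n\to\infty$, then $\nu$ is $\uplus_\times$-infinitely divisible.
   Context: $\mathbb{T}$ is the unit circle, $\mathbb{D}$ the open unit disk; $\mathcal{M}_{\mathbb{T}}^{\times}$ is the set of Borel probability measures $\mu$ on $\mathbb{T}$ with $\int_{\mathbb{T}}\zeta\,d\mu(\zeta)\ne0$; $\delta_\lambda$ is the point mass at $\lambda$. $\{k_n\}$ is a sequence of natural numbers. An array $\{\mu_{nk}\}_{n\in\mathbb{N},1\le k\le k_n}$ of probability measures on $\mathbb{T}$ is infinitesimal if $\lim_{n\to\infty}\max_{1\le k\le k_n}\mu_{nk}(\{\zeta\in\mathbb{T}:|\zeta-1|\ge\varepsilon\})=0$ for every $\varepsilon>0$. For a probability measure $\mu$ on $\mathbb{T}$ put $\psi_\mu(z)=\int_{\mathbb{T}}\frac{\zeta z}{1-\zeta z}\,d\mu(\zeta)$ and $B_\mu(z)=\frac1z\frac{\psi_\mu(z)}{1+\psi_\mu(z)}$, $z\in\mathbb{D}$ (with the singularity at $0$ removed). The map $\mu\mapsto B_\mu$ is a bijection from probability measures on $\mathbb{T}$ to analytic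 functions $\mathbb{D}\to\overline{\mathbb{D}}$. The multiplicative boolean convolution $\mu_1\uplus_\times\mu_2$ is the probability measure determined by $B_{\mu_1\uplus_\times\mu_2}(z)=B_{\mu_1}(z)B_{\mu_2}(z)$, $z\in\mathbb{D}$. A probability measure $\nu$ on $\mathbb{T}$ is $\uplus_\times$-infinitely divisible if for each $n\in\mathbb{N}$ there is a probability measure $\nu_n$ on $\mathbb{T}$ such that $\nu=\nu_n\uplus_\times\cdots\uplus_\times\nu_n$ ($n$ times). *)

theory Defs
  imports "HOL-Probability.Probability" "HOL-Complex_Analysis.Complex_Analysis"
begin

abbreviation unit_circle :: "complex set" where
  "unit_circle \<equiv> sphere 0 1"

abbreviation circle_borel :: "complex measure" where
  "circle_borel \<equiv> restrict_space borel unit_circle"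

text \<open>Probability measures on the circle have the circle itself, not the plane, as their
  underlying space.  Hence two of them that agree on all Borel subsets of the circle are equal
  as elements of the type of measures.\<close>

definition circle_probs :: "complex measure set" where
  "circle_probs = {\<mu>. prob_space \<mu> \<and> sets \<mu> = sets circle_borel}"

definition circle_probs_nz :: "complex measure set" where
  "circle_probs_nz = {\<mu> \<in> circle_probs. (LINT \<zeta>|\<mu>. \<zeta>) \<noteq> 0}"

definition circle_dirac :: "complex \<Rightarrow> complex measure" where
  "circle_dirac \<xi> = return circle_borel \<xi>"

definition psi_fun :: "complex measure \<Rightarrow> complex \<Rightarrow> complex" where
  "psi_fun \<mu> z = (LINT \<zeta>|\<mu>. \<zeta> * z / (1 - \<zeta> * z))"

text \<open>The quotient has a single, removable singularity in the open unit disk, namely at 0;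
  there \<^const>\<open>remove_sings\<close> supplies the limit.  The values outside the disk
  are irrelevant.\<close>

definition B_fun :: "complex measure \<Rightarrow> complex \<Rightarrow> complex" where
  "B_fun \<mu> = remove_sings (\<lambda>z. 1 / z * (psi_fun \<mu> z / (1 + psi_fun \<mu> z)))"

definition bool_conv :: "complex measure \<Rightarrow> complex measure \<Rightarrow> complex measure"
    (infixl \<open>\<uplus>\<^sub>\<times>\<close> 70) where
  "\<mu>1 \<uplus>\<^sub>\<times> \<mu>2 =
     (THE \<mu>. \<mu> \<in> circle_probs \<and> (\<forall>z\<in>ball 0 1. B_fun \<mu> z = B_fun \<mu>1 z * B_fun \<mu>2 z))"

definition bool_inf_divisible :: "complex measure \<Rightarrow> bool" where
  "bool_inf_divisible \<nu> \<longleftrightarrow> \<nu> \<in> circle_probs \<and>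
     (\<forall>n::nat\<ge>1. \<exists>\<rho>\<in>circle_probs. \<nu> = foldl (\<uplus>\<^sub>\<times>) \<rho> (replicate (n - 1) \<rho>))"

text \<open>Row \<open>n \<ge> 1\<close> of an array consists of the measures \<open>\<mu> n j\<close> with
  \<open>1 \<le> j \<le> k n\<close>; all other values of \<open>\<mu>\<close> are ignored.  The definition is meant
  for rows that are not empty, since the maximum of the empty set is unspecified.\<close>

definition infinitesimal_array :: "(nat \<Rightarrow> nat) \<Rightarrow> (nat \<Rightarrow> nat \<Rightarrow> complex measure) \<Rightarrow> bool" where
  "infinitesimal_array k \<mu> \<longleftrightarrow>
     (\<forall>\<epsilon>>0. (\<lambda>n. Max ((\<lambda>j. measure (\<mu> n j) {\<zeta> \<in> unit_circle. cmod (\<zeta> - 1) \<ge> \<epsilon>}) ` {1..k n}))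
        \<longlonglongrightarrow> 0)"

text \<open>The library's \<^const>\<open>weak_conv_m\<close> is restricted to measures on the real
  line.  Continuous functions on the circle are automatically bounded.\<close>

definition circle_weak_conv :: "(nat \<Rightarrow> complex measure) \<Rightarrow> complex measure \<Rightarrow> bool" where
  "circle_weak_conv M \<nu> \<longleftrightarrow>
     (\<forall>f :: complex \<Rightarrow> real. continuous_on unit_circle f \<longrightarrow>
        (\<lambda>n. LINT \<zeta>|M n. f \<zeta>) \<longlonglongrightarrow> (LINT \<zeta>|\<nu>. f \<zeta>))"

end

theory Submission
  imports Defs
begin

text \<open>A boolean convolution power corresponds to an ordinary power of the transform
  \<open>B\<close>, so \<open>\<nu>\<close> is infinitely divisible as soon as \<open>B\<^sub>\<nu>\<close> has analytic \<open>n\<close>-th roots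
  on the disk that are bounded by 1. This happens when \<open>B\<^sub>\<nu>\<close> has no zeros, since then it has an
  analytic logarithm, and also when it vanishes identically, since then it is its own \<open>n\<close>-th
  root (\<open>bool_inf_divisibleI\<close>).

  That one of the two cases occurs is Hurwitz's theorem. The \<open>n\<close>-th measure of the convergent
  sequence has the transform \<open>\<lambda>\<^sub>n \<Prod>\<^sub>j B\<^bsub>\<mu>(n,j)\<^esub>\<close>. On a disk of radius \<open>r < 1\<close> a measure
  sufficiently concentrated near 1 has a transform without zeros
  (\<open>B_fun_neq_0_near_dirac_1\<close>), and by infinitesimality this applies to all factors of a late
  row at once, however many there are. Weak convergence makes the transforms converge pointwise; they
  are bounded by 1, so Montel's theorem yields locally uniform convergence of a subsequence, and
  the limit \<open>B\<^sub>\<nu>\<close> is zero-free or identically zero (\<open>Hurwitz_disk_bounded\<close>).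

  All this rests on the bijection between probability measures on the circle and analytic maps from
  the open disk to the closed disk. Injectivity (\<open>circle_probs_eqI_B_fun\<close>): \<open>B\<^sub>\<mu>\<close> determines
  all moments of \<open>\<mu>\<close>, and these determine the measure by the Stone-Weierstrass theorem.
  Surjectivity (\<open>B_fun_surj\<close>) is the Herglotz representation of analytic functions with
  nonnegative real part: on smaller circles the Schwarz integral formula provides representing
  measures, and a weak limit point of these is the measure sought.\<close>

section \<open>Probability measures on the circle\<close>

lemma circle_probsD:
  assumes "\<mu> \<in> circle_probs"
  shows "prob_space \<mu>" "sets \<mu> = sets circle_borel" "space \<mu> = unit_circle"
proof -
  show "prob_space \<mu>" and s: "sets \<mu> = sets circle_borel"
    using assms by (auto simp: circle_probs_def)
  show "space \<mu> = unit_circle"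
    using sets_eq_imp_space_eq[OF s] by (simp add: space_restrict_space)
qed

lemma measurable_circle_probs:
  fixes f :: "complex \<Rightarrow> 'b::topological_space"
  assumes "\<mu> \<in> circle_probs" "continuous_on unit_circle f"
  shows "f \<in> borel_measurable \<mu>"
  using borel_measurable_continuous_on_restrict[OF assms(2)]
    measurable_cong_sets[OF circle_probsD(2)[OF assms(1)] refl] by blast

lemma integrable_circle_probs:
  fixes f :: "complex \<Rightarrow> 'b::{banach,second_countable_topology}"
  assumes \<mu>: "\<mu> \<in> circle_probs" and f: "continuous_on unit_circle f"
  shows "integrable \<mu> f"
proof -
  interpret prob_space \<mu> by (rule circle_probsD[OF \<mu>])
  have "bounded (f ` unit_circle)"
    using compact_continuous_image[OF f] compact_imp_bounded by auto
  then obtain K where "\<And>x. x \<in> unit_circle \<Longrightarrow> norm (f x) \<le> K"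
    by (metis bounded_iff imageI)
  then show ?thesis
    by (intro integrable_const_bound[where B=K] measurable_circle_probs[OF \<mu> f] AE_I2)
       (simp add: circle_probsD(3)[OF \<mu>])
qed

text \<open>The indicator of a closed set \<open>C\<close> is the decreasing limit of the continuous functions
  \<open>max 0 (1 - n * dist x C)\<close>, and the closed sets form an intersection-stable generator of the
  Borel sets.\<close>

lemma circle_probs_eqI_continuous:
  assumes \<mu>: "\<mu> \<in> circle_probs" and \<nu>: "\<nu> \<in> circle_probs"
    and eq: "\<And>f::complex \<Rightarrow> real. continuous_on unit_circle f
               \<Longrightarrow> (LINT \<zeta>|\<mu>. f \<zeta>) = (LINT \<zeta>|\<nu>. f \<zeta>)"
  shows "\<mu> = \<nu>"
proof -
  define E where "E = {C::complex set. closed C \<and> C \<subseteq> unit_circle}"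
  have sets_E: "sets circle_borel = sigma_sets unit_circle E"
  proof -
    have "unit_circle \<in> sigma_sets UNIV (Collect closed)"
      by (rule sigma_sets.Basic) simp
    then have "(\<inter>) unit_circle ` sigma_sets UNIV (Collect closed)
          = sigma_sets unit_circle ((\<inter>) unit_circle ` Collect closed)"
      by (rule sigma_sets_Int) simp
    moreover have "(\<inter>) unit_circle ` Collect closed = E"
      unfolding E_def by (auto intro!: image_eqI[where x="_::complex set"])
    ultimately show ?thesis
      by (simp add: sets_restrict_space borel_eq_closed)
  qed
  have measure_eq: "measure \<mu> C = measure \<nu> C" if C: "C \<in> E" for C
  proof (cases "C = {}")
    case False
    define f where "f = (\<lambda>n x. max 0 (1 - real n * infdist x C))"
    have lim: "(\<lambda>n. f n x) \<longlonglongrightarrow> indicator C x" for x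
    proof (cases "x \<in> C")
      case True
      then show ?thesis by (simp add: f_def)
    next
      case x: False
      have "infdist x C > 0"
        using C False x by (intro infdist_pos_not_in_closed) (auto simp: E_def)
      then obtain N where N: "1 < real N * infdist x C"
        using reals_Archimedean3 by blast
      have "f n x = 0" if "n \<ge> N" for n
      proof -
        have "real N * infdist x C \<le> real n * infdist x C"
          using that by (intro mult_right_mono infdist_nonneg) auto
        then show ?thesis using N by (simp add: f_def)
      qed
      then have "eventually (\<lambda>n. f n x = 0) sequentially"
        by (rule eventually_sequentiallyI)
      then show ?thesis
        using x by (simp add: tendsto_eventually)
    qed
    have cont: "continuous_on unit_circle (f n)" for n
      unfolding f_def by (intro continuous_intros)
    have conv: "(\<lambda>n. LINT x|M. f n x) \<longlonglongrightarrow> measure M C" if M: "M \<in> circle_probs" for M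
    proof -
      interpret prob_space M by (rule circle_probsD[OF M])
      have CM: "C \<in> sets M"
        using C sets_E circle_probsD(2)[OF M] by (auto intro: sigma_sets.Basic)
      have "(\<lambda>n. LINT x|M. f n x) \<longlonglongrightarrow> (LINT x|M. indicator C x)"
        by (rule integral_dominated_convergence[where w="\<lambda>_. 1"])
           (use CM lim measurable_circle_probs[OF M cont] in
             \<open>auto simp: f_def infdist_nonneg\<close>)
      then show ?thesis using CM by simp
    qed
    have "(\<lambda>n. LINT x|\<mu>. f n x) = (\<lambda>n. LINT x|\<nu>. f n x)"
      using eq[OF cont] by simp
    then show ?thesis
      using conv[OF \<mu>] conv[OF \<nu>] LIMSEQ_unique by metis
  qed auto
  interpret \<mu>: prob_space \<mu> by (rule circle_probsD[OF \<mu>])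
  interpret \<nu>: prob_space \<nu> by (rule circle_probsD[OF \<nu>])
  show ?thesis
  proof (rule measure_eqI_generator_eq[where E=E and \<Omega>=unit_circle and A="\<lambda>_. unit_circle"])
    show "Int_stable E" by (auto simp: Int_stable_def E_def)
    show "emeasure \<mu> X = emeasure \<nu> X" if "X \<in> E" for X
      using measure_eq[OF that] by (simp add: \<mu>.emeasure_eq_measure \<nu>.emeasure_eq_measure)
  qed (use sets_E circle_probsD[OF \<mu>] circle_probsD[OF \<nu>] in \<open>auto simp: E_def\<close>)
qed

text \<open>On the circle \<open>cnj \<zeta> = 1 / \<zeta>\<close>, so polynomials in the two real coordinates are Laurent
  polynomials in \<open>\<zeta>\<close>. Splitting off a power of \<open>cnj \<zeta>\<close> expresses them without negative
  exponents.\<close>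

lemma real_polynomial_on_circle:
  assumes "real_polynomial_function f"
  shows "\<exists>N p. \<forall>\<zeta>\<in>unit_circle. complex_of_real (f \<zeta>) = poly p \<zeta> * cnj \<zeta> ^ N"
  using assms
proof (induction rule: real_polynomial_function.induct)
  case (linear f)
  interpret bounded_linear f by fact
  define a b where "a = complex_of_real (f 1)" and "b = complex_of_real (f \<i>)"
  have "complex_of_real (f \<zeta>) = poly [:(a + \<i> * b) / 2, 0, (a - \<i> * b) / 2:] \<zeta> * cnj \<zeta> ^ 1"
    if "\<zeta> \<in> unit_circle" for \<zeta>
  proof -
    have z: "\<zeta> * cnj \<zeta> = 1" using that by (simp add: complex_norm_square[symmetric])
    have "f \<zeta> = f (Re \<zeta> *\<^sub>R 1 + Im \<zeta> *\<^sub>R \<i>)"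
      by (rule arg_cong[where f=f]) (simp add: complex_eq_iff)
    also have "\<dots> = Re \<zeta> * f 1 + Im \<zeta> * f \<i>" by (simp only: add scaleR) simp
    finally have "complex_of_real (f \<zeta>) = a * Re \<zeta> + b * Im \<zeta>"
      by (simp add: a_def b_def mult.commute)
    also have "\<dots> = (a + \<i> * b) / 2 * cnj \<zeta> + (a - \<i> * b) / 2 * \<zeta>"
      by (simp add: complex_eq_iff a_def b_def field_simps)
    also have "\<dots> = (a + \<i> * b) / 2 * cnj \<zeta> + (a - \<i> * b) / 2 * \<zeta> * (\<zeta> * cnj \<zeta>)"
      using z by simp
    finally show ?thesis by (simp add: algebra_simps)
  qed
  then show ?case by blast
next
  case (const c)
  show ?case by (rule exI[of _ 0], rule exI[of _ "[:complex_of_real c:]"]) simp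
next
  case (add f g)
  then obtain N p M q where
    f: "\<And>\<zeta>. \<zeta> \<in> unit_circle \<Longrightarrow> complex_of_real (f \<zeta>) = poly p \<zeta> * cnj \<zeta> ^ N" and
    g: "\<And>\<zeta>. \<zeta> \<in> unit_circle \<Longrightarrow> complex_of_real (g \<zeta>) = poly q \<zeta> * cnj \<zeta> ^ M"
    by blast
  have "complex_of_real (f \<zeta> + g \<zeta>)
      = poly (p * monom 1 M + q * monom 1 N) \<zeta> * cnj \<zeta> ^ (N + M)" if "\<zeta> \<in> unit_circle" for \<zeta>
  proof -
    have "\<zeta> * cnj \<zeta> = 1" using that by (simp add: complex_norm_square[symmetric])
    then have z: "\<zeta> ^ n * cnj \<zeta> ^ n = 1" for n by (simp flip: power_mult_distrib)
    have "complex_of_real (f \<zeta> + g \<zeta>)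
        = poly p \<zeta> * cnj \<zeta> ^ N * (\<zeta> ^ M * cnj \<zeta> ^ M) + poly q \<zeta> * cnj \<zeta> ^ M * (\<zeta> ^ N * cnj \<zeta> ^ N)"
      using f[OF that] g[OF that] by (simp add: z)
    then show ?thesis by (simp add: poly_monom algebra_simps power_add)
  qed
  then show ?case by blast
next
  case (mult f g)
  then obtain N p M q where
    f: "\<And>\<zeta>. \<zeta> \<in> unit_circle \<Longrightarrow> complex_of_real (f \<zeta>) = poly p \<zeta> * cnj \<zeta> ^ N" and
    g: "\<And>\<zeta>. \<zeta> \<in> unit_circle \<Longrightarrow> complex_of_real (g \<zeta>) = poly q \<zeta> * cnj \<zeta> ^ M"
    by blast
  have "complex_of_real (f \<zeta> * g \<zeta>) = poly (p * q) \<zeta> * cnj \<zeta> ^ (N + M)"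
    if "\<zeta> \<in> unit_circle" for \<zeta>
    using f[OF that] g[OF that] by (simp add: power_add)
  then show ?case by blast
qed

text \<open>The moments of negative order are the conjugates of those of positive order, so the moments
  determine the integrals of Laurent polynomials. By Stone-Weierstrass these approximate every
  continuous function uniformly on the circle.\<close>

lemma circle_probs_eqI_moments:
  assumes \<mu>: "\<mu> \<in> circle_probs" and \<nu>: "\<nu> \<in> circle_probs"
    and mom: "\<And>n::nat. (LINT \<zeta>|\<mu>. \<zeta> ^ n) = (LINT \<zeta>|\<nu>. \<zeta> ^ n)"
  shows "\<mu> = \<nu>"
proof (rule circle_probs_eqI_continuous[OF \<mu> \<nu>])
  have mono: "(LINT \<zeta>|\<mu>. \<zeta> ^ i * cnj \<zeta> ^ N) = (LINT \<zeta>|\<nu>. \<zeta> ^ i * cnj \<zeta> ^ N)" for i N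
  proof (cases "N \<le> i")
    case True
    have *: "(LINT \<zeta>|M. \<zeta> ^ i * cnj \<zeta> ^ N) = (LINT \<zeta>|M. \<zeta> ^ (i - N))" if "M \<in> circle_probs" for M
    proof (rule Bochner_Integration.integral_cong)
      fix \<zeta> assume "\<zeta> \<in> space M"
      then have "\<zeta> * cnj \<zeta> = 1"
        using circle_probsD(3)[OF that] by (simp add: complex_norm_square[symmetric])
      then have "\<zeta> ^ N * cnj \<zeta> ^ N = 1" by (simp flip: power_mult_distrib)
      then have "\<zeta> ^ (i - N) * (\<zeta> ^ N * cnj \<zeta> ^ N) = \<zeta> ^ (i - N)" by simp
      then show "\<zeta> ^ i * cnj \<zeta> ^ N = \<zeta> ^ (i - N)"
        using True by (simp add: mult.assoc[symmetric] power_add[symmetric])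
    qed simp
    show ?thesis using *[OF \<mu>] *[OF \<nu>] mom by simp
  next
    case False
    have *: "(LINT \<zeta>|M. \<zeta> ^ i * cnj \<zeta> ^ N) = (LINT \<zeta>|M. cnj (\<zeta> ^ (N - i)))"
      if "M \<in> circle_probs" for M
    proof (rule Bochner_Integration.integral_cong)
      fix \<zeta> assume "\<zeta> \<in> space M"
      then have "\<zeta> * cnj \<zeta> = 1"
        using circle_probsD(3)[OF that] by (simp add: complex_norm_square[symmetric])
      then have "\<zeta> ^ i * cnj \<zeta> ^ i = 1" by (simp flip: power_mult_distrib)
      then have "(\<zeta> ^ i * cnj \<zeta> ^ i) * cnj \<zeta> ^ (N - i) = cnj (\<zeta> ^ (N - i))" by simp
      then show "\<zeta> ^ i * cnj \<zeta> ^ N = cnj (\<zeta> ^ (N - i))"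
        using False by (simp add: mult.assoc power_add[symmetric])
    qed simp
    show ?thesis using *[OF \<mu>] *[OF \<nu>] mom
      by (simp only: Bochner_Integration.integral_cnj)
  qed
  have poly_eq: "(LINT \<zeta>|\<mu>. g \<zeta>) = (LINT \<zeta>|\<nu>. g \<zeta>)" if g: "real_polynomial_function g" for g
  proof -
    obtain N p where
      p: "\<And>\<zeta>. \<zeta> \<in> unit_circle \<Longrightarrow> complex_of_real (g \<zeta>) = poly p \<zeta> * cnj \<zeta> ^ N"
      using real_polynomial_on_circle[OF g] by blast
    have *: "complex_of_real (LINT \<zeta>|M. g \<zeta>)
        = (\<Sum>i\<le>degree p. coeff p i * (LINT \<zeta>|M. \<zeta> ^ i * cnj \<zeta> ^ N))"
      if M: "M \<in> circle_probs" for M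
    proof -
      have "complex_of_real (LINT \<zeta>|M. g \<zeta>) = (LINT \<zeta>|M. complex_of_real (g \<zeta>))"
        by (simp add: integral_complex_of_real)
      also have "\<dots> = (LINT \<zeta>|M. (\<Sum>i\<le>degree p. coeff p i * (\<zeta> ^ i * cnj \<zeta> ^ N)))"
        by (rule Bochner_Integration.integral_cong)
           (auto simp: circle_probsD(3)[OF M] p poly_altdef sum_distrib_right mult.assoc)
      also have "\<dots> = (\<Sum>i\<le>degree p. LINT \<zeta>|M. coeff p i * (\<zeta> ^ i * cnj \<zeta> ^ N))"
        by (intro Bochner_Integration.integral_sum integrable_circle_probs[OF M] continuous_intros)
      finally show ?thesis by simp
    qed
    show ?thesis using *[OF \<mu>] *[OF \<nu>] mono by (metis (no_types, lifting) of_real_eq_iff sum.cong)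
  qed
  fix f :: "complex \<Rightarrow> real" assume f: "continuous_on unit_circle f"
  (* If the integrals differed by 2e, a polynomial e-close to f would also have different integrals. *)
  show "(LINT \<zeta>|\<mu>. f \<zeta>) = (LINT \<zeta>|\<nu>. f \<zeta>)"
  proof (rule ccontr)
    assume ne: "\<not> ?thesis"
    define e where "e = \<bar>(LINT \<zeta>|\<mu>. f \<zeta>) - (LINT \<zeta>|\<nu>. f \<zeta>)\<bar> / 2"
    have "e > 0" using ne by (simp add: e_def)
    then obtain g where g: "real_polynomial_function g" and
      fg: "\<And>x. x \<in> unit_circle \<Longrightarrow> \<bar>f x - g x\<bar> < e"
      using Stone_Weierstrass_real_polynomial_function[OF compact_sphere f] by metis
    have cg: "continuous_on unit_circle g"
      using g real_polynomial_function_eq continuous_on_polymonial_function by blast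
    have close: "\<bar>(LINT \<zeta>|M. f \<zeta>) - (LINT \<zeta>|M. g \<zeta>)\<bar> < e" if M: "M \<in> circle_probs" for M
    proof -
      interpret prob_space M by (rule circle_probsD[OF M])
      have i: "integrable M f" "integrable M g" "integrable M (\<lambda>x. \<bar>f x - g x\<bar>)"
        using f cg by (intro integrable_circle_probs[OF M] continuous_intros; simp)+
      have "\<bar>(LINT \<zeta>|M. f \<zeta>) - (LINT \<zeta>|M. g \<zeta>)\<bar> = \<bar>LINT \<zeta>|M. f \<zeta> - g \<zeta>\<bar>"
        using i by simp
      also have "\<dots> \<le> (LINT \<zeta>|M. \<bar>f \<zeta> - g \<zeta>\<bar>)" by (rule integral_abs_bound)
      also have "\<dots> < e"
        using i(3) fg by (intro expectation_less AE_I2) (auto simp: circle_probsD(3)[OF M])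
      finally show ?thesis .
    qed
    show False using close[OF \<mu>] close[OF \<nu>] poly_eq[OF g] by (simp add: e_def abs_if split: if_splits)
  qed
qed

section \<open>The transform B determines the measure\<close>

text \<open>This is \<open>\<psi>\<^sub>\<mu>(z) / z\<close>, including its value at \<open>z = 0\<close>. In terms of it \<open>B\<^sub>\<mu>\<close> has a
  formula that is valid on the whole disk, which disposes of the removable singularity.\<close>

definition cauchy_int :: "complex measure \<Rightarrow> complex \<Rightarrow> complex" where
  "cauchy_int \<mu> z = (LINT \<zeta>|\<mu>. \<zeta> / (1 - \<zeta> * z))"

lemma one_minus_mult_circle_neq_0:
  fixes z \<zeta> :: complex
  assumes "norm z < 1" "norm \<zeta> = 1"
  shows "1 - \<zeta> * z \<noteq> 0"
proof
  assume "1 - \<zeta> * z = 0"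
  then have "norm (\<zeta> * z) = 1" by (metis eq_iff_diff_eq_0 norm_one)
  with assms show False by (simp add: norm_mult)
qed

text \<open>The Taylor coefficients of \<open>cauchy_int \<mu>\<close> are the moments of \<open>\<mu>\<close>: expand the kernel into a
  geometric series and integrate term by term.\<close>

lemma cauchy_int_sums:
  assumes \<mu>: "\<mu> \<in> circle_probs" and z: "norm z < 1"
  shows "(\<lambda>n. (LINT \<zeta>|\<mu>. \<zeta> ^ Suc n) * z ^ n) sums cauchy_int \<mu> z"
proof -
  interpret prob_space \<mu> by (rule circle_probsD[OF \<mu>])
  let ?f = "\<lambda>n \<zeta>. \<zeta> ^ Suc n * z ^ n"
  have nf: "norm (?f n \<zeta>) = norm z ^ n" if "\<zeta> \<in> space \<mu>" for n \<zeta>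
    using that by (simp add: circle_probsD(3)[OF \<mu>] norm_mult norm_power)
  have int_nf: "(LINT \<zeta>|\<mu>. norm (?f n \<zeta>)) = norm z ^ n" for n
    using nf Bochner_Integration.integral_cong[of \<mu> \<mu> "\<lambda>\<zeta>. norm (?f n \<zeta>)" "\<lambda>_. norm z ^ n"]
    by (simp add: prob_space)
  have geo: "summable (\<lambda>n. norm z ^ n)" using z by (intro summable_geometric) simp
  have "(\<lambda>n. LINT \<zeta>|\<mu>. ?f n \<zeta>) sums (LINT \<zeta>|\<mu>. (\<Sum>n. ?f n \<zeta>))"
  proof (rule sums_integral)
    show "integrable \<mu> (?f n)" for n
      by (intro integrable_circle_probs[OF \<mu>] continuous_intros)
    show "AE \<zeta> in \<mu>. summable (\<lambda>n. norm (?f n \<zeta>))"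
      by (rule AE_I2) (simp only: nf geo)
    show "summable (\<lambda>n. LINT \<zeta>|\<mu>. norm (?f n \<zeta>))"
      by (simp only: int_nf geo)
  qed
  moreover have "(LINT \<zeta>|\<mu>. (\<Sum>n. ?f n \<zeta>)) = cauchy_int \<mu> z"
    unfolding cauchy_int_def
  proof (rule Bochner_Integration.integral_cong)
    fix \<zeta> assume "\<zeta> \<in> space \<mu>"
    then have "norm (\<zeta> * z) < 1" using z by (simp add: circle_probsD(3)[OF \<mu>] norm_mult)
    then have "(\<lambda>n. \<zeta> * (\<zeta> * z) ^ n) sums (\<zeta> * (1 / (1 - \<zeta> * z)))"
      by (intro sums_mult geometric_sums)
    then show "(\<Sum>n. ?f n \<zeta>) = \<zeta> / (1 - \<zeta> * z)"
      by (simp add: power_mult_distrib mult.assoc sums_iff)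
  qed simp
  moreover have "(LINT \<zeta>|\<mu>. ?f n \<zeta>) = (LINT \<zeta>|\<mu>. \<zeta> ^ Suc n) * z ^ n" for n
    by (rule integral_mult_left_zero)
  ultimately show ?thesis by simp
qed

lemma cauchy_int_holomorphic:
  assumes "\<mu> \<in> circle_probs"
  shows "cauchy_int \<mu> holomorphic_on ball 0 1"
  by (rule power_series_holomorphic[where a="\<lambda>n. LINT \<zeta>|\<mu>. \<zeta> ^ Suc n"])
     (use cauchy_int_sums[OF assms] in simp)

lemma psi_fun_eq_cauchy_int: "psi_fun \<mu> z = z * cauchy_int \<mu> z"
proof -
  have "psi_fun \<mu> z = (LINT \<zeta>|\<mu>. z * (\<zeta> / (1 - \<zeta> * z)))"
    by (simp add: psi_fun_def mult.commute)
  also have "\<dots> = z * cauchy_int \<mu> z"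
    unfolding cauchy_int_def by (rule integral_mult_right_zero)
  finally show ?thesis .
qed

text \<open>The map \<open>w \<mapsto> w / (1 - w)\<close> takes the open unit disk to the half-plane \<open>Re > - 1 / 2\<close>,
  which is preserved by averaging. This inequality keeps the denominator \<open>1 + \<psi>\<close> away from 0 and,
  being equivalent to \<open>\<bar>\<psi>\<bar> < \<bar>1 + \<psi>\<bar>\<close>, gives the bound on \<open>B\<close>.\<close>

lemma Re_psi_fun_gt:
  assumes \<mu>: "\<mu> \<in> circle_probs" and z: "norm z < 1"
  shows "Re (psi_fun \<mu> z) > - 1 / 2"
proof -
  interpret prob_space \<mu> by (rule circle_probsD[OF \<mu>])
  let ?f = "\<lambda>\<zeta>. \<zeta> * z / (1 - \<zeta> * z)"
  have pos: "Re (?f \<zeta>) > - 1 / 2" if "\<zeta> \<in> space \<mu>" for \<zeta>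
  proof -
    define w where "w = \<zeta> * z"
    have "norm \<zeta> = 1" using that by (simp add: circle_probsD(3)[OF \<mu>])
    then have w: "norm w < 1" and ne: "1 - w \<noteq> 0"
      using z one_minus_mult_circle_neq_0 by (auto simp: w_def norm_mult)
    have "(Re w)\<^sup>2 + (Im w)\<^sup>2 < 1"
      using w by (simp flip: cmod_power2 add: power_less_one_iff)
    moreover have "(1 - Re w)\<^sup>2 + (Im w)\<^sup>2 > 0"
      using ne by (auto simp: complex_eq_iff sum_power2_gt_zero_iff)
    ultimately have "Re (w / (1 - w)) > - 1 / 2"
      by (simp add: Re_divide field_simps power2_eq_square)
    then show ?thesis by (simp add: w_def)
  qed
  have int: "integrable \<mu> ?f"
    using one_minus_mult_circle_neq_0[OF z]
    by (intro integrable_circle_probs[OF \<mu>] continuous_intros) auto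
  have "(LINT \<zeta>|\<mu>. Re (?f \<zeta>)) > - 1 / 2"
    using int pos by (intro expectation_greater AE_I2 integrable_Re) auto
  then show ?thesis using int by (simp add: psi_fun_def)
qed

lemma B_denominator_neq_0:
  assumes "\<mu> \<in> circle_probs" "norm z < 1"
  shows "1 + z * cauchy_int \<mu> z \<noteq> 0"
proof
  assume "1 + z * cauchy_int \<mu> z = 0"
  then have "Re (psi_fun \<mu> z) = - 1"
    unfolding psi_fun_eq_cauchy_int by (metis add_eq_0_iff one_complex.sel(1) uminus_complex.sel(1))
  then show False using Re_psi_fun_gt[OF assms] by simp
qed

lemma B_fun_eq:
  assumes \<mu>: "\<mu> \<in> circle_probs" and z: "norm z < 1"
  shows "B_fun \<mu> z = cauchy_int \<mu> z / (1 + z * cauchy_int \<mu> z)"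
  unfolding B_fun_def
proof (rule remove_sings_eqI)
  let ?q = "\<lambda>w. cauchy_int \<mu> w / (1 + w * cauchy_int \<mu> w)"
  have "?q holomorphic_on ball 0 1"
    using B_denominator_neq_0[OF \<mu>] by (intro holomorphic_intros cauchy_int_holomorphic \<mu>) auto
  then have "continuous_on (ball 0 1) ?q" by (rule holomorphic_on_imp_continuous_on)
  then have "isCont ?q z" using z by (simp add: continuous_on_eq_continuous_at)
  then have lim: "?q \<midarrow>z\<rightarrow> ?q z" by (simp add: isCont_def)
  have "eventually (\<lambda>w. ?q w = 1 / w * (psi_fun \<mu> w / (1 + psi_fun \<mu> w))) (at z)"
    using eventually_neq_at_within[of 0 z UNIV]
    by eventually_elim (simp add: psi_fun_eq_cauchy_int)
  then show "(\<lambda>w. 1 / w * (psi_fun \<mu> w / (1 + psi_fun \<mu> w))) \<midarrow>z\<rightarrow> ?q z"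
    using lim by (rule Lim_transform_eventually[rotated])
qed

lemma B_fun_holomorphic:
  assumes \<mu>: "\<mu> \<in> circle_probs"
  shows "B_fun \<mu> holomorphic_on ball 0 1"
proof -
  have "(\<lambda>w. cauchy_int \<mu> w / (1 + w * cauchy_int \<mu> w)) holomorphic_on ball 0 1"
    using B_denominator_neq_0[OF \<mu>] by (intro holomorphic_intros cauchy_int_holomorphic \<mu>) auto
  then show ?thesis
    by (rule holomorphic_transform) (simp add: B_fun_eq[OF \<mu>])
qed

text \<open>The Schwarz lemma applies to \<open>z B\<^sub>\<mu>(z) = \<psi> / (1 + \<psi>)\<close>, a self-map of the disk that fixes 0;
  at the origin the bound is the one for the derivative.\<close>

lemma norm_B_fun_le_1:
  assumes \<mu>: "\<mu> \<in> circle_probs" and z: "norm z < 1"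
  shows "norm (B_fun \<mu> z) \<le> 1"
proof -
  let ?f = "\<lambda>z. z * B_fun \<mu> z"
  have hol: "?f holomorphic_on ball 0 1" by (intro holomorphic_intros B_fun_holomorphic \<mu>)
  have lt: "norm (?f w) < 1" if w: "norm w < 1" for w
  proof -
    define p where "p = psi_fun \<mu> w"
    have "Re p > - 1 / 2" using Re_psi_fun_gt[OF \<mu> w] by (simp add: p_def)
    then have "(norm p)\<^sup>2 < (norm (1 + p))\<^sup>2"
      unfolding cmod_power2 by (simp add: power2_eq_square algebra_simps)
    then have "norm p < norm (1 + p)" by (rule power2_less_imp_less) simp
    then have "norm (p / (1 + p)) < 1" by (simp add: norm_divide divide_less_eq)
    moreover have "?f w = p / (1 + p)"
      by (simp add: B_fun_eq[OF \<mu> w] p_def psi_fun_eq_cauchy_int)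
    ultimately show ?thesis by simp
  qed
  show ?thesis
  proof (cases "z = 0")
    case True
    have "(B_fun \<mu> has_field_derivative deriv (B_fun \<mu>) 0) (at 0)"
      using B_fun_holomorphic[OF \<mu>] by (rule holomorphic_derivI) auto
    then have "(?f has_field_derivative (0 * deriv (B_fun \<mu>) 0 + 1 * B_fun \<mu> 0)) (at 0)"
      by (intro DERIV_mult') auto
    then have "deriv ?f 0 = B_fun \<mu> 0" by (simp add: DERIV_imp_deriv)
    then show ?thesis using Schwarz_Lemma(2)[OF hol _ lt, of 0] True by simp
  next
    case False
    then show ?thesis using Schwarz_Lemma(1)[OF hol _ lt z] by (simp add: norm_mult)
  qed
qed

lemma cauchy_int_eq_B_fun:
  assumes \<mu>: "\<mu> \<in> circle_probs" and z: "norm z < 1"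
  shows "cauchy_int \<mu> z = B_fun \<mu> z / (1 - z * B_fun \<mu> z)"
proof -
  define g where "g = cauchy_int \<mu> z"
  have "1 + z * g \<noteq> 0" using B_denominator_neq_0[OF \<mu> z] by (simp add: g_def)
  moreover from this have "1 - z * (g / (1 + z * g)) = 1 / (1 + z * g)" by (simp add: field_simps)
  ultimately have "g = g / (1 + z * g) / (1 - z * (g / (1 + z * g)))" by simp
  then show ?thesis by (simp add: B_fun_eq[OF \<mu> z] g_def)
qed

lemma power_series_coeffs_unique:
  fixes a b :: "nat \<Rightarrow> complex"
  assumes "r > 0"
    and a: "\<And>z. norm z < r \<Longrightarrow> (\<lambda>n. a n * z ^ n) sums f z"
    and b: "\<And>z. norm z < r \<Longrightarrow> (\<lambda>n. b n * z ^ n) sums f z"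
  shows "a n = b n"
proof -
  have s: "(\<lambda>n. (a n - b n) * (z - 0) ^ n) sums (\<lambda>_. 0) z" if "norm (z - 0) < r" for z
    using sums_diff[OF a b, of z z] that by (simp add: left_diff_distrib)
  have "a 0 = f 0" "b 0 = f 0" using a[of 0] b[of 0] \<open>r > 0\<close> by auto
  moreover have "a n - b n = 0" if "n > 0"
  proof (rule ccontr)
    assume "a n - b n \<noteq> 0"
    then obtain t where "t > 0" "\<And>z. z \<in> cball 0 t - {0} \<Longrightarrow> (\<lambda>_::complex. 0::complex) z \<noteq> 0"
      using powser_0_nonzero[where f="\<lambda>_. 0" and \<xi>=0 and a="\<lambda>n. a n - b n" and m=n, OF \<open>r > 0\<close> s] \<open>n > 0\<close>
      by blast
    from this(2)[of "of_real t"] this(1) show False by simp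
  qed
  ultimately show ?thesis by (cases "n = 0") auto
qed

lemma circle_probs_eqI_B_fun:
  assumes \<mu>: "\<mu> \<in> circle_probs" and \<nu>: "\<nu> \<in> circle_probs"
    and eq: "\<And>z. z \<in> ball 0 1 \<Longrightarrow> B_fun \<mu> z = B_fun \<nu> z"
  shows "\<mu> = \<nu>"
proof (rule circle_probs_eqI_moments[OF \<mu> \<nu>])
  interpret \<mu>: prob_space \<mu> by (rule circle_probsD[OF \<mu>])
  interpret \<nu>: prob_space \<nu> by (rule circle_probsD[OF \<nu>])
  have c: "cauchy_int \<mu> z = cauchy_int \<nu> z" if "norm z < 1" for z
    using cauchy_int_eq_B_fun[OF \<mu> that] cauchy_int_eq_B_fun[OF \<nu> that] eq[of z] that by simp
  have "(LINT \<zeta>|\<mu>. \<zeta> ^ Suc n) = (LINT \<zeta>|\<nu>. \<zeta> ^ Suc n)" for n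
    by (rule power_series_coeffs_unique[where r=1 and f="cauchy_int \<mu>"])
       (use cauchy_int_sums[OF \<mu>] cauchy_int_sums[OF \<nu>] c in auto)
  then show "(LINT \<zeta>|\<mu>. \<zeta> ^ n) = (LINT \<zeta>|\<nu>. \<zeta> ^ n)" for n
    by (cases n) (simp_all add: \<mu>.prob_space \<nu>.prob_space)
qed

lemma circle_dirac_in_circle_probs:
  assumes "\<xi> \<in> unit_circle"
  shows "circle_dirac \<xi> \<in> circle_probs"
  using assms by (auto simp: circle_probs_def circle_dirac_def space_restrict_space
      intro!: prob_space_return)

lemma B_fun_circle_dirac:
  assumes \<xi>: "\<xi> \<in> unit_circle" and z: "norm z < 1"
  shows "B_fun (circle_dirac \<xi>) z = \<xi>"
proof -
  have ne: "1 - \<xi> * z \<noteq> 0" using one_minus_mult_circle_neq_0[OF z] \<xi> by simp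
  have "(\<lambda>\<zeta>. \<zeta> / (1 - \<zeta> * z)) \<in> borel_measurable circle_borel"
    using one_minus_mult_circle_neq_0[OF z]
    by (intro borel_measurable_continuous_on_restrict continuous_intros) auto
  then have "cauchy_int (circle_dirac \<xi>) z = \<xi> / (1 - \<xi> * z)"
    unfolding cauchy_int_def circle_dirac_def
    using \<xi> by (intro integral_return) (auto simp: space_restrict_space)
  moreover have "1 + z * (\<xi> / (1 - \<xi> * z)) = 1 / (1 - \<xi> * z)"
    using ne by (simp add: divide_simps)
  ultimately show ?thesis
    using ne by (simp add: B_fun_eq[OF circle_dirac_in_circle_probs[OF \<xi>] z])
qed

section \<open>Every analytic self-map of the disk is a transform B\<close>

text \<open>Cauchy's integral formula with the circle parametrized by \<open>cis (2 * pi * t)\<close>; as a plain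
  integral over the unit interval it can be read as integration against a measure on the real line,
  where tightness arguments are available.\<close>

lemma Cauchy_integral_unit_circle:
  assumes f: "f holomorphic_on cball 0 1" and a: "norm a < 1"
  shows "((\<lambda>t. f (cis (2 * pi * t)) * (cis (2 * pi * t) / (cis (2 * pi * t) - a))) has_integral f a) {0..1}"
proof -
  have cp: "circlepath 0 1 t = cis (2 * pi * t)" for t
    by (simp add: circlepath cis_conv_exp mult_ac)
  have e: "exp (2 * complex_of_real pi * \<i> * complex_of_real t) = cis (2 * pi * t)" for t
    by (simp add: cis_conv_exp mult_ac)
  have "((\<lambda>u. f u / (u - a)) has_contour_integral (2 * of_real pi * \<i> * f a)) (circlepath 0 1)"
    using f a by (intro Cauchy_integral_circlepath_simple) auto
  then have "((\<lambda>t. f (cis (2 * pi * t)) / (cis (2 * pi * t) - a) * (2 * pi * \<i> * cis (2 * pi * t)))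
      has_integral (2 * pi * \<i> * f a)) {0..1}"
    unfolding has_contour_integral cp vector_derivative_circlepath e by simp
  then have "((\<lambda>t. 1 / (2 * pi * \<i>) * (f (cis (2 * pi * t)) / (cis (2 * pi * t) - a) * (2 * pi * \<i> * cis (2 * pi * t))))
      has_integral (1 / (2 * pi * \<i>) * (2 * pi * \<i> * f a))) {0..1}"
    by (rule has_integral_mult_right)
  moreover have "1 / (2 * pi * \<i>) * (u / v * (2 * pi * \<i> * w)) = u * (w / v)" for u v w :: complex
    by (cases "v = 0") (simp_all add: field_simps)
  ultimately show ?thesis by simp
qed

lemma cis_minus_neq_0:
  assumes "norm z < 1"
  shows "cis t - z \<noteq> 0"
  using assms norm_cis[of t] by force

text \<open>Write \<open>e\<close> for a point of the circle and \<open>2 Re H = H + cnj H\<close>. The kernel splits as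
  \<open>(e + z) / (e - z) = 2 e / (e - z) - e / (e - 0)\<close>, so the part with \<open>H\<close> contributes
  \<open>2 H(z) - H(0)\<close> by Cauchy's formula. On the circle the conjugate of the kernel agrees with a
  function analytic on the closed disk and equal to 1 at 0, so the part with \<open>cnj H\<close> contributes
  \<open>cnj (H(0)) = H(0)\<close>.\<close>

lemma Schwarz_integral_formula:
  assumes H: "H holomorphic_on cball 0 1" and H0: "Im (H 0) = 0" and z: "norm z < 1"
  shows "((\<lambda>t. Re (H (cis (2 * pi * t))) *\<^sub>R ((cis (2 * pi * t) + z) / (cis (2 * pi * t) - z)))
           has_integral H z) {0..1}"
proof -
  define e where "e t = cis (2 * pi * t)" for t
  have ne: "e t - z \<noteq> 0" "e t \<noteq> 0" for t using cis_minus_neq_0[OF z] by (auto simp: e_def)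
  have "((\<lambda>t. 2 * (H (e t) * (e t / (e t - z))) - H (e t) * (e t / (e t - 0))) has_integral
          (2 * H z - H 0)) {0..1}"
    unfolding e_def
    by (intro has_integral_diff has_integral_mult_right Cauchy_integral_unit_circle H z) simp
  moreover have "2 * (H (e t) * (e t / (e t - z))) - H (e t) * (e t / (e t - 0))
      = H (e t) * ((e t + z) / (e t - z))" for t
    using ne[of t] by (simp add: field_simps)
  ultimately have 1: "((\<lambda>t. H (e t) * ((e t + z) / (e t - z))) has_integral (2 * H z - H 0)) {0..1}"
    by simp
  (* On the circle, where cnj w = 1 / w, the second factor is the conjugate of the kernel. *)
  define g where "g w = H w * ((1 + cnj z * w) / (1 - cnj z * w))" for w
  have ne': "1 - cnj z * w \<noteq> 0" if "norm w \<le> 1" for w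
  proof
    assume "1 - cnj z * w = 0"
    then have "norm z * norm w = 1" by (metis eq_iff_diff_eq_0 norm_one norm_mult complex_mod_cnj)
    then show False using z that mult_left_le[of "norm w" "norm z"] by simp
  qed
  have "g holomorphic_on cball 0 1"
    unfolding g_def using ne' by (intro holomorphic_intros H) auto
  then have "((\<lambda>t. g (e t) * (e t / (e t - 0))) has_integral g 0) {0..1}"
    unfolding e_def by (intro Cauchy_integral_unit_circle) auto
  then have "((\<lambda>t. g (e t)) has_integral H 0) {0..1}"
    using ne by (simp add: g_def)
  then have "(cnj \<circ> (\<lambda>t. g (e t)) has_integral cnj (H 0)) {0..1}"
    by (simp only: has_integral_cnj)
  moreover have "cnj \<circ> (\<lambda>t. g (e t)) = (\<lambda>t. cnj (H (e t)) * ((e t + z) / (e t - z)))"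
  proof
    fix t
    have c: "cnj (e t) = 1 / e t" by (simp add: e_def cis_cnj inverse_eq_divide flip: cis_inverse)
    have "(1 + z * (1 / e t)) / (1 - z * (1 / e t)) = (e t + z) / (e t - z)"
      using ne[of t] by (simp add: divide_simps)
    then show "(cnj \<circ> (\<lambda>t. g (e t))) t = cnj (H (e t)) * ((e t + z) / (e t - z))"
      by (simp only: o_def g_def c complex_cnj_mult complex_cnj_divide complex_cnj_add
          complex_cnj_diff complex_cnj_one complex_cnj_cnj)
  qed
  ultimately have 2: "((\<lambda>t. cnj (H (e t)) * ((e t + z) / (e t - z))) has_integral cnj (H 0)) {0..1}"
    by (simp only:)
  have "((\<lambda>t. 1 / 2 * (H (e t) * ((e t + z) / (e t - z)) + cnj (H (e t)) * ((e t + z) / (e t - z))))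
     has_integral (1 / 2 * (2 * H z - H 0 + cnj (H 0)))) {0..1}"
    by (intro has_integral_mult_right has_integral_add 1 2)
  moreover have "1 / 2 * (2 * H z - H 0 + cnj (H 0)) = H z"
    using H0 by (simp add: complex_eq_iff)
  moreover have "1 / 2 * (H (e t) * ((e t + z) / (e t - z)) + cnj (H (e t)) * ((e t + z) / (e t - z)))
      = Re (H (e t)) *\<^sub>R ((e t + z) / (e t - z))" for t
    unfolding distrib_right[symmetric] complex_add_cnj by (simp add: scaleR_conv_of_real)
  ultimately show ?thesis unfolding e_def by (simp only:)
qed

text \<open>For a function analytic up to the boundary, its real part on the circle is the density of a
  representing measure; the case \<open>z = 0\<close> of the Schwarz formula shows that the total mass is 1.
  The measure lives on the real line and is carried by the unit interval.\<close>

lemma Herglotz_approximant: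
  assumes H: "H holomorphic_on cball 0 1" and H0: "H 0 = 1"
    and pos: "\<And>t. Re (H (cis t)) \<ge> 0"
  obtains Q where "real_distribution Q" "measure Q {-1<..1} = 1"
    "\<And>z. norm z < 1 \<Longrightarrow>
       (LINT t|Q. (cis (2 * pi * t) + z) / (cis (2 * pi * t) - z)) = H z"
proof -
  define d where "d t = indicator {0..1} t * Re (H (cis (2 * pi * t)))" for t :: real
  have contH: "continuous_on UNIV (\<lambda>t. H (cis (2 * pi * t)))"
    by (rule continuous_on_compose2[OF holomorphic_on_imp_continuous_on[OF H]])
       (auto intro!: continuous_intros)
  have contR: "continuous_on A (\<lambda>t. Re (H (cis (2 * pi * t))))" for A
    using continuous_on_subset[OF contH] by (intro continuous_on_Re) auto
  have d_meas [measurable]: "d \<in> borel_measurable borel"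
    unfolding d_def using contR[of UNIV]
    by (intro borel_measurable_times borel_measurable_indicator borel_measurable_continuous_onI) auto
  have d_nonneg: "d t \<ge> 0" for t using pos by (simp add: d_def)
  define Q where "Q = density lborel (\<lambda>t. ennreal (d t))"
  have int: "(LINT t|Q. f t) = integral {0..1} (\<lambda>t. Re (H (cis (2 * pi * t))) *\<^sub>R f t)"
    and intble: "set_integrable lborel {0..1} (\<lambda>t. Re (H (cis (2 * pi * t))) *\<^sub>R f t)"
    if f: "continuous_on UNIV f" for f :: "real \<Rightarrow> complex"
  proof -
    show i: "set_integrable lborel {0..1} (\<lambda>t. Re (H (cis (2 * pi * t))) *\<^sub>R f t)"
      by (intro borel_integrable_atLeastAtMost' continuous_intros contR
            continuous_on_subset[OF f]) auto
    have "(LINT t|Q. f t) = (LINT t|lborel. d t *\<^sub>R f t)"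
      unfolding Q_def using borel_measurable_continuous_onI[OF f] d_nonneg
      by (intro integral_density) auto
    also have "\<dots> = (LINT t:{0..1}|lborel. Re (H (cis (2 * pi * t))) *\<^sub>R f t)"
      by (simp add: set_lebesgue_integral_def d_def)
    finally show "(LINT t|Q. f t) = integral {0..1} (\<lambda>t. Re (H (cis (2 * pi * t))) *\<^sub>R f t)"
      using set_borel_integral_eq_integral(2)[OF i] by simp
  qed
  have kernel: "(LINT t|Q. (cis (2 * pi * t) + z) / (cis (2 * pi * t) - z)) = H z"
    if z: "norm z < 1" for z
  proof -
    have "continuous_on UNIV (\<lambda>t. (cis (2 * pi * t) + z) / (cis (2 * pi * t) - z))"
      using cis_minus_neq_0[OF z] by (intro continuous_intros) auto
    then show ?thesis
      using Schwarz_integral_formula[OF H _ z] H0 by (simp add: int integral_unique)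
  qed
  have "prob_space Q"
  proof
    have "integrable lborel (\<lambda>t. complex_of_real (d t))"
      using intble[of "\<lambda>_. 1"] by (simp add: set_integrable_def d_def scaleR_conv_of_real)
    then have di: "integrable lborel d" by (simp only: complex_of_real_integrable_eq)
    have "complex_of_real (LINT t|lborel. d t) = (LINT t|lborel. d t *\<^sub>R (1::complex))"
      by (simp add: scaleR_conv_of_real integral_complex_of_real)
    also have "\<dots> = (LINT t|Q. 1)"
      unfolding Q_def using d_nonneg by (intro integral_density[symmetric]) auto
    also have "\<dots> = (LINT t|Q. (cis (2 * pi * t) + 0) / (cis (2 * pi * t) - 0))" by simp
    also have "\<dots> = 1" using kernel[of 0] H0 by simp
    finally have "(LINT t|lborel. d t) = 1" by (simp only: of_real_eq_1_iff)
    then show "emeasure Q (space Q) = 1"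
      using nn_integral_eq_integral[OF di] d_nonneg by (simp add: Q_def emeasure_density)
  qed
  then interpret Q: prob_space Q .
  have "real_distribution Q" by unfold_locales (simp add: Q_def)
  moreover have "d t = 0" if "t \<notin> {-1<..1}" for t
    using that by (auto simp: d_def split: split_indicator)
  then have "t \<in> {-1<..1}" if "0 < ennreal (d t)" for t
    using that by fastforce
  then have "AE t in Q. t \<in> {-1<..1}"
    unfolding Q_def by (subst AE_density) auto
  then have "measure Q {-1<..1} = 1"
    by (subst Q.prob_eq_1) (auto simp: Q_def)
  ultimately show thesis using kernel that by blast
qed

text \<open>The dilations \<open>z \<mapsto> h (r z)\<close> with \<open>r < 1\<close> are analytic up to the boundary and thus have
  representing measures on the unit interval. These are tight, so by Helly's theorem they have a weak
  limit point as \<open>r\<close> tends to 1. The kernel is bounded and continuous, so the limit represents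
  \<open>h\<close>. It is then transported to the circle, with a conjugation because the kernel here is
  \<open>(1 + \<zeta> z) / (1 - \<zeta> z)\<close> and not \<open>(\<zeta> + z) / (\<zeta> - z)\<close>.\<close>

theorem Herglotz_representation:
  assumes h: "h holomorphic_on ball 0 1" and h0: "h 0 = 1"
    and pos: "\<And>z. norm z < 1 \<Longrightarrow> Re (h z) \<ge> 0"
  obtains \<mu> where "\<mu> \<in> circle_probs"
    "\<And>z. norm z < 1 \<Longrightarrow> (LINT \<zeta>|\<mu>. (1 + \<zeta> * z) / (1 - \<zeta> * z)) = h z"
proof -
  let ?K = "\<lambda>z t. (cis (2 * pi * t) + z) / (cis (2 * pi * t) - z)"
  define r where "r n = 1 - 1 / (real n + 2)" for n
  have r: "0 < r n" "r n < 1" for n by (auto simp: r_def field_simps)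
  have rz: "norm (of_real (r n) * z) < 1" if "norm z \<le> 1" for n and z :: complex
  proof -
    have "r n * norm z \<le> r n * 1" using r[of n] that by (intro mult_left_mono) auto
    moreover have "norm (of_real (r n) * z) = r n * norm z" using r[of n] by (simp add: norm_mult)
    ultimately show ?thesis using r(2)[of n] by linarith
  qed
  have "\<exists>Q. real_distribution Q \<and> measure Q {-1<..1} = 1 \<and>
      (\<forall>z. norm z < 1 \<longrightarrow> (LINT t|Q. ?K z t) = h (of_real (r n) * z))" for n
  proof -
    have hol: "(\<lambda>z. h (of_real (r n) * z)) holomorphic_on cball 0 1"
      using rz[of _ n] by (intro holomorphic_on_compose_gen[OF _ h, unfolded o_def] holomorphic_intros) auto
    have nonneg: "Re (h (of_real (r n) * cis t)) \<ge> 0" for t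
      by (intro pos rz) simp
    obtain Q where "real_distribution Q" "measure Q {-1<..1} = 1"
      "\<And>z. norm z < 1 \<Longrightarrow> (LINT t|Q. ?K z t) = h (of_real (r n) * z)"
      by (rule Herglotz_approximant[OF hol _ nonneg]) (simp_all add: h0)
    then show ?thesis by blast
  qed
  then obtain Q where Q: "\<And>n. real_distribution (Q n)" "\<And>n. measure (Q n) {-1<..1} = 1"
    and Qh: "\<And>n z. norm z < 1 \<Longrightarrow> (LINT t|Q n. ?K z t) = h (of_real (r n) * z)"
    using choice[of "\<lambda>n Q. real_distribution Q \<and> measure Q {-1<..1} = 1 \<and>
      (\<forall>z. norm z < 1 \<longrightarrow> (LINT t|Q. ?K z t) = h (of_real (r n) * z))"] by blast
  have "tight Q"
    unfolding tight_def using Q by (intro conjI allI impI exI[of _ "-1"] exI[of _ 1]) auto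
  then obtain s M where s: "strict_mono (s :: nat \<Rightarrow> nat)" and M: "real_distribution M"
    and conv: "weak_conv_m (Q \<circ> s) M"
    using tight_imp_convergent_subsubsequence[of Q id] by (auto simp: strict_mono_id)
  interpret M: real_distribution M by (rule M)
  have Mh: "(LINT t|M. ?K z t) = h z" if z: "norm z < 1" for z
  proof -
    have "continuous_on UNIV (?K z)"
      using cis_minus_neq_0[OF z] by (intro continuous_intros) auto
    then have cont: "isCont (?K z) t" for t
      by (simp add: continuous_on_eq_continuous_at)
    have bdd: "norm (?K z t) \<le> 2 / (1 - norm z)" for t
    proof -
      have "norm (cis (2 * pi * t) - z) \<ge> 1 - norm z" "norm (cis (2 * pi * t) + z) \<le> 1 + norm z"
        using norm_triangle_ineq2[of "cis (2 * pi * t)" z] norm_triangle_ineq[of "cis (2 * pi * t)" z]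
        by auto
      then show ?thesis unfolding norm_divide using z by (intro frac_le) auto
    qed
    have "(\<lambda>n. LINT t|(Q \<circ> s) n. ?K z t) \<longlonglongrightarrow> (LINT t|M. ?K z t)"
      using weak_conv_imp_integral_bdd_continuous_conv[OF _ M conv cont bdd] Q by simp
    then have 1: "(\<lambda>n. h (of_real (r (s n)) * z)) \<longlonglongrightarrow> (LINT t|M. ?K z t)"
      by (simp add: Qh[OF z])
    have "r \<longlonglongrightarrow> 1" unfolding r_def by real_asymp
    then have "(\<lambda>n. r (s n)) \<longlonglongrightarrow> 1" using LIMSEQ_subseq_LIMSEQ[OF _ s] by (simp add: o_def)
    then have "(\<lambda>n. of_real (r (s n)) * z) \<longlonglongrightarrow> of_real 1 * z" by (intro tendsto_intros)
    moreover have "isCont h z"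
      using holomorphic_on_imp_continuous_on[OF h] z by (simp add: continuous_on_eq_continuous_at)
    ultimately have "(\<lambda>n. h (of_real (r (s n)) * z)) \<longlonglongrightarrow> h z"
      using isCont_tendsto_compose[of z h] by simp
    then show ?thesis using 1 LIMSEQ_unique by blast
  qed
  let ?c = "\<lambda>t. cis (- (2 * pi * t))"
  define \<mu> where "\<mu> = distr M circle_borel ?c"
  have "?c \<in> borel_measurable borel"
    by (intro borel_measurable_continuous_onI continuous_intros)
  then have c: "?c \<in> measurable M circle_borel"
    by (intro measurable_restrict_space2) (auto simp: measurable_cong_sets[OF M.events_eq_borel refl])
  have \<mu>: "\<mu> \<in> circle_probs"
    using M.prob_space_distr[OF c] by (simp add: circle_probs_def \<mu>_def)
  moreover have "(LINT \<zeta>|\<mu>. (1 + \<zeta> * z) / (1 - \<zeta> * z)) = h z" if z: "norm z < 1" for z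
  proof -
    have "(LINT \<zeta>|\<mu>. (1 + \<zeta> * z) / (1 - \<zeta> * z)) = (LINT t|M. (1 + ?c t * z) / (1 - ?c t * z))"
      unfolding \<mu>_def using one_minus_mult_circle_neq_0[OF z]
      by (intro integral_distr c borel_measurable_continuous_on_restrict continuous_intros) auto
    also have "\<dots> = (LINT t|M. ?K z t)"
    proof (rule Bochner_Integration.integral_cong)
      fix t
      define e where "e = cis (2 * pi * t)"
      have "?c t = 1 / e" by (simp add: e_def cis_inverse[symmetric] inverse_eq_divide)
      moreover have "e \<noteq> 0" "e - z \<noteq> 0" using cis_minus_neq_0[OF z] by (auto simp: e_def)
      then have "(1 + 1 / e * z) / (1 - 1 / e * z) = (e + z) / (e - z)"
        by (simp add: divide_simps)
      ultimately show "(1 + ?c t * z) / (1 - ?c t * z) = ?K z t"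
        by (simp only: e_def)
    qed simp
    finally show ?thesis using Mh[OF z] by simp
  qed
  ultimately show thesis using that by blast
qed

text \<open>The Moebius map \<open>w \<mapsto> (1 + w) / (1 - w)\<close> takes the disk to the right half-plane. Applied to
  \<open>w = z b(z)\<close>, it gives a function to which the Herglotz representation applies, and the
  representing measure has \<open>1 + 2 \<psi> = (1 + z b) / (1 - z b)\<close>, that is,
  \<open>\<psi> / (1 + \<psi>) = z b\<close>.\<close>

theorem B_fun_surj:
  assumes b: "b holomorphic_on ball 0 1" and bound: "\<And>z. norm z < 1 \<Longrightarrow> norm (b z) \<le> 1"
  obtains \<mu> where "\<mu> \<in> circle_probs" "\<And>z. z \<in> ball 0 1 \<Longrightarrow> B_fun \<mu> z = b z"
proof -
  have zb: "norm (z * b z) < 1" if "norm z < 1" for z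
    using that bound[OF that] mult_left_le[of "norm (b z)" "norm z"] by (simp add: norm_mult)
  have ne: "1 - z * b z \<noteq> 0" if "norm z < 1" for z
    using zb[OF that] by force
  define h where "h z = (1 + z * b z) / (1 - z * b z)" for z
  have "h holomorphic_on ball 0 1"
    unfolding h_def using ne by (intro holomorphic_intros b) auto
  moreover have "h 0 = 1" by (simp add: h_def)
  moreover have "Re (h z) \<ge> 0" if "norm z < 1" for z
  proof -
    define w where "w = z * b z"
    have "norm w < 1" using zb[OF that] by (simp add: w_def)
    then have "(Re w)\<^sup>2 + (Im w)\<^sup>2 \<le> 1"
      by (simp flip: cmod_power2 add: power_le_one)
    then have "Re ((1 + w) / (1 - w)) \<ge> 0"
      unfolding Re_divide
      by (intro divide_nonneg_nonneg sum_power2_ge_zero) (simp add: power2_eq_square algebra_simps)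
    then show ?thesis by (simp add: h_def w_def)
  qed
  ultimately obtain \<mu> where \<mu>: "\<mu> \<in> circle_probs"
    and int: "\<And>z. norm z < 1 \<Longrightarrow> (LINT \<zeta>|\<mu>. (1 + \<zeta> * z) / (1 - \<zeta> * z)) = h z"
    using Herglotz_representation by blast
  interpret prob_space \<mu> by (rule circle_probsD[OF \<mu>])
  have B: "B_fun \<mu> z = b z" if z: "norm z < 1" and "z \<noteq> 0" for z
  proof -
    have i: "integrable \<mu> (\<lambda>\<zeta>. \<zeta> * z / (1 - \<zeta> * z))"
      using one_minus_mult_circle_neq_0[OF z]
      by (intro integrable_circle_probs[OF \<mu>] continuous_intros) auto
    have "h z = (LINT \<zeta>|\<mu>. 1 + 2 * (\<zeta> * z / (1 - \<zeta> * z)))"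
      unfolding int[OF z, symmetric]
      by (rule Bochner_Integration.integral_cong)
         (use one_minus_mult_circle_neq_0[OF z] in \<open>auto simp: circle_probsD(3)[OF \<mu>] field_simps\<close>)
    also have "\<dots> = 1 + 2 * psi_fun \<mu> z"
      unfolding psi_fun_def
      by (subst Bochner_Integration.integral_add)
         (use i integrable_mult_right[OF i, of 2] in
           \<open>simp_all only: integrable_const integral_mult_right_zero lebesgue_integral_const prob_space scaleR_one\<close>)
    finally have "1 + 2 * psi_fun \<mu> z = (1 + z * b z) / (1 - z * b z)" by (simp add: h_def)
    also have "\<dots> = 1 + 2 * (z * b z / (1 - z * b z))"
      using ne[OF z] by (simp add: divide_simps)
    finally have "psi_fun \<mu> z = z * b z / (1 - z * b z)"
      by (simp only: add_left_cancel mult_cancel_left) simp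
    then have "z * cauchy_int \<mu> z = z * b z / (1 - z * b z)"
      by (simp only: psi_fun_eq_cauchy_int)
    then have "z * cauchy_int \<mu> z = z * (b z / (1 - z * b z))" by (simp only: times_divide_eq_right)
    then have G: "cauchy_int \<mu> z = b z / (1 - z * b z)"
      by (simp only: mult_left_cancel[OF \<open>z \<noteq> 0\<close>])
    have "1 + z * (b z / (1 - z * b z)) = 1 / (1 - z * b z)"
      using ne[OF z] by (simp add: divide_simps)
    then show ?thesis using ne[OF z] by (simp add: B_fun_eq[OF \<mu> z] G)
  qed
  have "B_fun \<mu> 0 = b 0"
  proof -
    have "isCont b 0" "isCont (B_fun \<mu>) 0"
      using holomorphic_on_imp_continuous_on[OF b]
        holomorphic_on_imp_continuous_on[OF B_fun_holomorphic[OF \<mu>]]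
      by (simp_all add: continuous_on_eq_continuous_at)
    then have lim: "b \<midarrow>0\<rightarrow> b 0" "B_fun \<mu> \<midarrow>0\<rightarrow> B_fun \<mu> 0" by (simp_all add: isCont_def)
    have "eventually (\<lambda>z. B_fun \<mu> z = b z) (at 0)"
      using B by (intro eventually_at_topological[THEN iffD2] exI[of _ "ball 0 1"]) auto
    then have "b \<midarrow>0\<rightarrow> B_fun \<mu> 0" using lim(2) by (simp add: tendsto_cong)
    then show ?thesis using lim(1) LIM_unique by blast
  qed
  then show thesis using that \<mu> B by (metis mem_ball_0)
qed

section \<open>Boolean convolution multiplies the transforms\<close>

text \<open>The definite description in the definition of the convolution denotes: a product of two
  transforms is again an analytic map of the disk into its closure, and so the transform of exactly
  one measure.\<close>

lemma bool_conv_circle_probs_and_B: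
  assumes \<mu>: "\<mu> \<in> circle_probs" and \<nu>: "\<nu> \<in> circle_probs"
  shows "\<mu> \<uplus>\<^sub>\<times> \<nu> \<in> circle_probs \<and>
    (\<forall>z\<in>ball 0 1. B_fun (\<mu> \<uplus>\<^sub>\<times> \<nu>) z = B_fun \<mu> z * B_fun \<nu> z)"
  unfolding bool_conv_def
proof (rule theI')
  have "(\<lambda>z. B_fun \<mu> z * B_fun \<nu> z) holomorphic_on ball 0 1"
    by (intro holomorphic_intros B_fun_holomorphic \<mu> \<nu>)
  moreover have "norm (B_fun \<mu> z * B_fun \<nu> z) \<le> 1" if "norm z < 1" for z
    using norm_B_fun_le_1[OF \<mu> that] norm_B_fun_le_1[OF \<nu> that]
    by (simp add: norm_mult mult_le_one)
  ultimately obtain \<rho> where "\<rho> \<in> circle_probs"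
    "\<And>z. z \<in> ball 0 1 \<Longrightarrow> B_fun \<rho> z = B_fun \<mu> z * B_fun \<nu> z"
    using B_fun_surj by blast
  then show "\<exists>!\<rho>. \<rho> \<in> circle_probs \<and> (\<forall>z\<in>ball 0 1. B_fun \<rho> z = B_fun \<mu> z * B_fun \<nu> z)"
    by (intro ex1I[of _ \<rho>]) (auto intro!: circle_probs_eqI_B_fun)
qed

lemma foldl_bool_conv_circle_probs_and_B:
  assumes "\<mu> \<in> circle_probs" "set \<rho>s \<subseteq> circle_probs"
  shows "foldl (\<uplus>\<^sub>\<times>) \<mu> \<rho>s \<in> circle_probs \<and>
    (\<forall>z\<in>ball 0 1. B_fun (foldl (\<uplus>\<^sub>\<times>) \<mu> \<rho>s) z = B_fun \<mu> z * (\<Prod>\<rho>\<leftarrow>\<rho>s. B_fun \<rho> z))"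
  using assms
proof (induction \<rho>s arbitrary: \<mu>)
  case (Cons \<rho> \<rho>s)
  then show ?case
    using bool_conv_circle_probs_and_B[of \<mu> \<rho>] Cons.IH[of "\<mu> \<uplus>\<^sub>\<times> \<rho>"] by (simp add: mult.assoc)
qed simp

section \<open>Transforms without zeros have convolution roots\<close>

text \<open>The \<open>n\<close>-th root of the transform is \<open>exp (g / n)\<close> for a logarithm \<open>g\<close>; it inherits the
  bound 1 and is therefore itself the transform of a measure.\<close>

lemma bool_inf_divisibleI:
  assumes \<nu>: "\<nu> \<in> circle_probs"
    and zeros: "(\<forall>z\<in>ball 0 1. B_fun \<nu> z = 0) \<or> (\<forall>z\<in>ball 0 1. B_fun \<nu> z \<noteq> 0)"
  shows "bool_inf_divisible \<nu>"
  unfolding bool_inf_divisible_def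
proof (intro conjI \<nu> allI impI)
  fix n :: nat assume n: "n \<ge> 1"
  obtain b where b: "b holomorphic_on ball 0 1"
    and bn: "\<And>z. z \<in> ball 0 1 \<Longrightarrow> b z ^ n = B_fun \<nu> z"
  proof (cases "\<forall>z\<in>ball 0 1. B_fun \<nu> z = 0")
    case True
    then show thesis using that[of "\<lambda>_. 0"] n by (simp add: power_0_left)
  next
    case False
    then have nz: "\<And>z. z \<in> ball 0 1 \<Longrightarrow> B_fun \<nu> z \<noteq> 0" using zeros by blast
    obtain g where g: "g holomorphic_on ball 0 1"
      "\<And>z. z \<in> ball 0 1 \<Longrightarrow> exp (g z) = B_fun \<nu> z"
      by (rule holomorphic_logarithm_exists[OF convex_ball open_ball B_fun_holomorphic[OF \<nu>] nz
            centre_in_ball[THEN iffD2, OF zero_less_one]]) auto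
    have "(\<lambda>z. exp (g z / of_nat n)) holomorphic_on ball 0 1"
      using n by (intro holomorphic_intros g) auto
    moreover have "exp (g z / of_nat n) ^ n = B_fun \<nu> z" if "z \<in> ball 0 1" for z
      using g(2)[OF that] n by (simp flip: exp_of_nat_mult)
    ultimately show thesis using that by blast
  qed
  have "norm (b z) \<le> 1" if "norm z < 1" for z
  proof -
    have "norm (b z) ^ n \<le> 1"
      using bn[of z] norm_B_fun_le_1[OF \<nu> that] that by (simp flip: norm_power)
    then show ?thesis using n by (simp add: power_le_one_iff)
  qed
  with b obtain \<rho> where \<rho>: "\<rho> \<in> circle_probs" "\<And>z. z \<in> ball 0 1 \<Longrightarrow> B_fun \<rho> z = b z"
    using B_fun_surj by blast
  have "\<nu> = foldl (\<uplus>\<^sub>\<times>) \<rho> (replicate (n - 1) \<rho>)"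
  proof (rule circle_probs_eqI_B_fun[OF \<nu>])
    have *: "set (replicate (n - 1) \<rho>) \<subseteq> circle_probs" using \<rho>(1) by auto
    show "foldl (\<uplus>\<^sub>\<times>) \<rho> (replicate (n - 1) \<rho>) \<in> circle_probs"
      using foldl_bool_conv_circle_probs_and_B[OF \<rho>(1) *] by blast
    fix z :: complex assume z: "z \<in> ball 0 1"
    have "B_fun (foldl (\<uplus>\<^sub>\<times>) \<rho> (replicate (n - 1) \<rho>)) z = b z * b z ^ (n - 1)"
      using foldl_bool_conv_circle_probs_and_B[OF \<rho>(1) *] z \<rho>(2)[OF z]
      by (simp add: prod_list_replicate)
    also have "\<dots> = B_fun \<nu> z" using n bn[OF z] by (simp flip: power_Suc)
    finally show "B_fun \<nu> z = B_fun (foldl (\<uplus>\<^sub>\<times>) \<rho> (replicate (n - 1) \<rho>)) z" by simp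
  qed
  then show "\<exists>\<rho>\<in>circle_probs. \<nu> = foldl (\<uplus>\<^sub>\<times>) \<rho> (replicate (n - 1) \<rho>)"
    using \<rho>(1) by blast
qed

section \<open>Measures concentrated near 1\<close>

lemma integral_dist_1_le:
  assumes \<mu>: "\<mu> \<in> circle_probs" and "\<epsilon> \<ge> 0"
  shows "(LINT \<zeta>|\<mu>. cmod (\<zeta> - 1)) \<le> \<epsilon> + 2 * measure \<mu> {\<zeta> \<in> unit_circle. cmod (\<zeta> - 1) \<ge> \<epsilon>}"
proof -
  interpret prob_space \<mu> by (rule circle_probsD[OF \<mu>])
  define A where "A = {\<zeta> \<in> unit_circle. cmod (\<zeta> - 1) \<ge> \<epsilon>}"
  have "A = unit_circle \<inter> {\<zeta>. \<epsilon> \<le> cmod (\<zeta> - 1)}" by (auto simp: A_def)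
  then have "closed A"
    by (simp only:) (intro closed_Int closed_sphere closed_Collect_le continuous_intros)
  then have A: "A \<in> sets \<mu>"
    unfolding circle_probsD(2)[OF \<mu>] by (auto simp: sets_restrict_space_iff A_def)
  have iA: "integrable \<mu> (\<lambda>\<zeta>. 2 * indicator A \<zeta> :: real)"
    using A by (intro integrable_mult_right) (auto simp: emeasure_eq_measure)
  have "(LINT \<zeta>|\<mu>. cmod (\<zeta> - 1)) \<le> (LINT \<zeta>|\<mu>. \<epsilon> + 2 * indicator A \<zeta>)"
  proof (rule integral_mono)
    show "integrable \<mu> (\<lambda>\<zeta>. cmod (\<zeta> - 1))"
      by (intro integrable_circle_probs[OF \<mu>] continuous_intros)
    show "integrable \<mu> (\<lambda>\<zeta>. \<epsilon> + 2 * indicator A \<zeta>)"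
      by (intro Bochner_Integration.integrable_add iA integrable_const)
    fix \<zeta> assume "\<zeta> \<in> space \<mu>"
    then have \<zeta>: "norm \<zeta> = 1" by (simp add: circle_probsD(3)[OF \<mu>])
    then have "cmod (\<zeta> - 1) \<le> 2" using norm_triangle_ineq4[of \<zeta> 1] by simp
    then show "cmod (\<zeta> - 1) \<le> \<epsilon> + 2 * indicator A \<zeta>"
      using \<zeta> \<open>\<epsilon> \<ge> 0\<close> by (auto simp: A_def split: split_indicator)
  qed
  also have "\<dots> = (LINT \<zeta>|\<mu>. \<epsilon>) + (LINT \<zeta>|\<mu>. 2 * indicator A \<zeta>)"
    by (intro Bochner_Integration.integral_add iA integrable_const)
  also have "\<dots> = \<epsilon> + 2 * measure \<mu> A"
    using A by (simp add: prob_space)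
  finally show ?thesis by (simp add: A_def)
qed

text \<open>The comparison function \<open>1 / (1 - z)\<close> belongs to the point mass at 1; the two kernels differ by
  \<open>(\<zeta> - 1) / ((1 - \<zeta> z) (1 - z))\<close>.\<close>

lemma cauchy_int_near_dirac_1:
  assumes \<mu>: "\<mu> \<in> circle_probs" and z: "norm z \<le> r" and r: "r < 1"
  shows "cmod (cauchy_int \<mu> z - 1 / (1 - z)) \<le> (LINT \<zeta>|\<mu>. cmod (\<zeta> - 1)) / (1 - r)\<^sup>2"
proof -
  interpret prob_space \<mu> by (rule circle_probsD[OF \<mu>])
  have z1: "norm z < 1" using z r by simp
  have i: "integrable \<mu> (\<lambda>\<zeta>. \<zeta> / (1 - \<zeta> * z))" "integrable \<mu> (\<lambda>\<zeta>. cmod (\<zeta> - 1) / (1 - r)\<^sup>2)"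
    using one_minus_mult_circle_neq_0[OF z1] r
    by (intro integrable_circle_probs[OF \<mu>] continuous_intros; simp)+
  have "cauchy_int \<mu> z - 1 / (1 - z) = (LINT \<zeta>|\<mu>. \<zeta> / (1 - \<zeta> * z) - 1 / (1 - z))"
    using i(1) by (simp add: cauchy_int_def prob_space)
  also have "cmod \<dots> \<le> (LINT \<zeta>|\<mu>. cmod (\<zeta> - 1) / (1 - r)\<^sup>2)"
  proof (rule Bochner_Integration.integral_norm_bound_integral)
    fix \<zeta> assume "\<zeta> \<in> space \<mu>"
    then have \<zeta>: "norm \<zeta> = 1" by (simp add: circle_probsD(3)[OF \<mu>])
    have ne: "1 - \<zeta> * z \<noteq> 0" "1 - z \<noteq> 0"
      using one_minus_mult_circle_neq_0[OF z1 \<zeta>] one_minus_mult_circle_neq_0[OF z1, of 1] by auto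
    have lower: "cmod (1 - \<zeta> * z) \<ge> 1 - r" "cmod (1 - z) \<ge> 1 - r"
      using norm_triangle_ineq2[of 1 "\<zeta> * z"] norm_triangle_ineq2[of 1 z] z \<zeta>
      by (auto simp: norm_mult)
    have "\<zeta> / (1 - \<zeta> * z) - 1 / (1 - z) = (\<zeta> - 1) / ((1 - \<zeta> * z) * (1 - z))"
      using ne by (simp add: divide_simps) (simp add: algebra_simps)
    also have "cmod \<dots> = cmod (\<zeta> - 1) / (cmod (1 - \<zeta> * z) * cmod (1 - z))"
      by (simp add: norm_divide norm_mult)
    also have "\<dots> \<le> cmod (\<zeta> - 1) / (1 - r)\<^sup>2"
      unfolding power2_eq_square using r lower ne by (intro divide_left_mono mult_mono mult_pos_pos) auto
    finally show "cmod (\<zeta> / (1 - \<zeta> * z) - 1 / (1 - z)) \<le> cmod (\<zeta> - 1) / (1 - r)\<^sup>2" .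
  qed (use i in auto)
  also have "\<dots> = (LINT \<zeta>|\<mu>. cmod (\<zeta> - 1)) / (1 - r)\<^sup>2" by simp
  finally show ?thesis .
qed

text \<open>A zero of \<open>B\<^sub>\<mu>\<close> is a zero of \<open>cauchy_int \<mu>\<close>. But \<open>1 / (1 - z)\<close> exceeds \<open>1 / 2\<close> in
  modulus on the disk, and \<open>cauchy_int \<mu>\<close> is closer to it than that.\<close>

lemma B_fun_neq_0_near_dirac_1:
  assumes \<mu>: "\<mu> \<in> circle_probs" and z: "norm z \<le> r" and r: "r < 1"
    and close: "(LINT \<zeta>|\<mu>. cmod (\<zeta> - 1)) < (1 - r)\<^sup>2 / 2"
  shows "B_fun \<mu> z \<noteq> 0"
proof
  have z1: "norm z < 1" using z r by simp
  assume "B_fun \<mu> z = 0"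
  then have "cauchy_int \<mu> z = 0" by (simp add: cauchy_int_eq_B_fun[OF \<mu> z1])
  then have "1 / cmod (1 - z) \<le> (LINT \<zeta>|\<mu>. cmod (\<zeta> - 1)) / (1 - r)\<^sup>2"
    using cauchy_int_near_dirac_1[OF \<mu> z r] by (simp add: norm_divide)
  also have "\<dots> < 1 / 2" using close r by (simp add: field_simps)
  finally have "1 / cmod (1 - z) < 1 / 2" .
  moreover have "0 < cmod (1 - z)" using z1 by auto
  ultimately have "2 < cmod (1 - z)" by (simp add: field_simps)
  then show False using norm_triangle_ineq4[of 1 z] z1 by simp
qed

section \<open>Passing to the limit\<close>

lemma circle_weak_conv_imp_B_fun_tendsto:
  assumes conv: "circle_weak_conv M \<nu>" and M: "\<And>n. M n \<in> circle_probs" and \<nu>: "\<nu> \<in> circle_probs"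
    and z: "norm z < 1"
  shows "(\<lambda>n. B_fun (M n) z) \<longlonglongrightarrow> B_fun \<nu> z"
proof -
  let ?f = "\<lambda>\<zeta>. \<zeta> / (1 - \<zeta> * z)"
  have f: "continuous_on unit_circle ?f"
    using one_minus_mult_circle_neq_0[OF z] by (intro continuous_intros) auto
  have i: "integrable \<rho> ?f" if "\<rho> \<in> circle_probs" for \<rho>
    by (rule integrable_circle_probs[OF that f])
  have "(\<lambda>n. LINT \<zeta>|M n. Re (?f \<zeta>)) \<longlonglongrightarrow> (LINT \<zeta>|\<nu>. Re (?f \<zeta>))"
    "(\<lambda>n. LINT \<zeta>|M n. Im (?f \<zeta>)) \<longlonglongrightarrow> (LINT \<zeta>|\<nu>. Im (?f \<zeta>))"
    using conv continuous_on_Re[OF f] continuous_on_Im[OF f] unfolding circle_weak_conv_def by blast+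
  then have "(\<lambda>n. cauchy_int (M n) z) \<longlonglongrightarrow> cauchy_int \<nu> z"
    unfolding tendsto_complex_iff cauchy_int_def using i M \<nu> by simp
  then show ?thesis
    unfolding B_fun_eq[OF M z] B_fun_eq[OF \<nu> z]
    by (intro tendsto_intros B_denominator_neq_0[OF \<nu> z])
qed

text \<open>Each disk of radius \<open>r < 1\<close> becomes free of zeros only from some index on, so Hurwitz's
  theorem is applied on a disk that contains both a zero and a non-zero of the limit, to a
  tail of a locally uniformly convergent subsequence given by Montel's theorem.\<close>

lemma Hurwitz_disk_bounded:
  fixes F :: "nat \<Rightarrow> complex \<Rightarrow> complex"
  assumes F: "\<And>n. F n holomorphic_on ball 0 1" and bound: "\<And>n z. norm z < 1 \<Longrightarrow> norm (F n z) \<le> C"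
    and lim: "\<And>z. norm z < 1 \<Longrightarrow> (\<lambda>n. F n z) \<longlonglongrightarrow> g z"
    and nz: "\<And>r. 0 < r \<Longrightarrow> r < 1 \<Longrightarrow> eventually (\<lambda>n. \<forall>z\<in>ball 0 r. F n z \<noteq> 0) sequentially"
  shows "(\<forall>z\<in>ball 0 1. g z = 0) \<or> (\<forall>z\<in>ball 0 1. g z \<noteq> 0)"
proof (rule ccontr)
  assume "\<not> ?thesis"
  then obtain z0 z1 where z0: "norm z0 < 1" "g z0 = 0" and z1: "norm z1 < 1" "g z1 \<noteq> 0" by auto
  obtain r where r: "max 0 (max (norm z0) (norm z1)) < r" "r < 1"
    using dense[of "max 0 (max (norm z0) (norm z1))" 1] z0 z1 by auto
  define \<H> where "\<H> = {h. h holomorphic_on ball 0 1 \<and> (\<forall>z. norm z < 1 \<longrightarrow> norm (h z) \<le> C)}"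
  obtain G s where G: "G holomorphic_on ball 0 1" and s: "strict_mono (s :: nat \<Rightarrow> nat)"
    and pt: "\<And>x. x \<in> ball 0 1 \<Longrightarrow> (\<lambda>n. F (s n) x) \<longlonglongrightarrow> G x"
    and ul: "\<And>K. compact K \<Longrightarrow> K \<subseteq> ball 0 1 \<Longrightarrow> uniform_limit K (F \<circ> s) G sequentially"
  proof (rule Montel[of "ball 0 1" \<H> F])
    show "range F \<subseteq> \<H>" using F bound by (auto simp: \<H>_def)
    show "\<exists>B. \<forall>h\<in>\<H>. \<forall>z\<in>K. norm (h z) \<le> B" if "K \<subseteq> ball 0 1" for K
      using that by (intro exI[of _ C]) (auto simp: \<H>_def)
  qed (auto simp: \<H>_def)
  have Gg: "G z = g z" if "norm z < 1" for z
    using LIMSEQ_unique[OF pt LIMSEQ_subseq_LIMSEQ[OF lim s, unfolded o_def]] that by auto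
  obtain N where N: "\<And>n z. n \<ge> N \<Longrightarrow> z \<in> ball 0 r \<Longrightarrow> F n z \<noteq> 0"
    using nz[of r] r unfolding eventually_sequentially by (meson max.strict_boundedE)
  have sub: "ball 0 r \<subseteq> ball (0::complex) 1" using r by auto
  have "G z0 \<noteq> 0"
  proof (rule Hurwitz_no_zeros[of "ball 0 r" "\<lambda>n. F (s (n + N))" G z0])
    show "uniform_limit K (\<lambda>n. F (s (n + N))) G sequentially" if K: "compact K" "K \<subseteq> ball 0 r" for K
      using ul[OF K(1)] K(2) sub
      by (auto simp: uniform_limit_iff o_def intro!: sequentially_offset[where P="\<lambda>n. \<forall>x\<in>K. dist (F (s n) x) (G x) < _"])
    show "F (s (n + N)) z \<noteq> 0" if "z \<in> ball 0 r" for n z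
      using N[OF _ that] seq_suble[OF s, of "n + N"] by simp
    show "\<not> G constant_on ball 0 r"
    proof
      assume "G constant_on ball 0 r"
      then have "G z0 = G z1" using r by (auto simp: constant_on_def)
      then show False using z0 z1 Gg by simp
    qed
  qed (use r F G sub in \<open>auto intro: holomorphic_on_subset\<close>)
  then show False using Gg z0 by simp
qed

theorem theorem3p4:
  fixes k :: "nat \<Rightarrow> nat"
    and \<mu> :: "nat \<Rightarrow> nat \<Rightarrow> complex measure"
    and lam :: "nat \<Rightarrow> complex"
    and \<nu> :: "complex measure"
  assumes "\<And>n. n \<ge> 1 \<Longrightarrow> k n \<ge> 1"
    and "\<And>n j. n \<ge> 1 \<Longrightarrow> 1 \<le> j \<Longrightarrow> j \<le> k n \<Longrightarrow> \<mu> n j \<in> circle_probs_nz"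
    and "infinitesimal_array k \<mu>"
    and "\<And>n. n \<ge> 1 \<Longrightarrow> lam n \<in> unit_circle"
    and "\<nu> \<in> circle_probs"
    and "circle_weak_conv
           (\<lambda>n. foldl (\<uplus>\<^sub>\<times>) (circle_dirac (lam n)) (map (\<mu> n) [1..<Suc (k n)])) \<nu>"
  shows "bool_inf_divisible \<nu>"
proof -
  (* Hypotheses concern rows n \<ge> 1 only, so the sequence is shifted by one. *)
  define M where "M n = foldl (\<uplus>\<^sub>\<times>) (circle_dirac (lam (Suc n)))
      (map (\<mu> (Suc n)) [1..<Suc (k (Suc n))])" for n
  have \<mu>: "\<mu> (Suc n) j \<in> circle_probs" if "j \<in> {1..k (Suc n)}" for n j
    using assms(2)[of "Suc n" j] that by (simp add: circle_probs_nz_def)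
  let ?row = "\<lambda>n. map (\<mu> (Suc n)) [1..<Suc (k (Suc n))]"
  have row: "set (?row n) \<subseteq> circle_probs" for n
    using \<mu> by auto
  have lam: "lam (Suc n) \<in> unit_circle" for n
    by (rule assms(4)) simp
  have M_B: "M n \<in> circle_probs \<and> (\<forall>z\<in>ball 0 1.
      B_fun (M n) z = B_fun (circle_dirac (lam (Suc n))) z * (\<Prod>\<rho>\<leftarrow>?row n. B_fun \<rho> z))" for n
    unfolding M_def
    by (rule foldl_bool_conv_circle_probs_and_B[OF circle_dirac_in_circle_probs[OF lam] row])
  have M: "M n \<in> circle_probs" for n by (rule conjunct1[OF M_B])
  have B_M: "B_fun (M n) z = lam (Suc n) * (\<Prod>\<rho>\<leftarrow>?row n. B_fun \<rho> z)" if "norm z < 1" for n z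
    using M_B[of n] that B_fun_circle_dirac[OF lam that, of n] by (simp only: mem_ball_0)
  have conv: "circle_weak_conv M \<nu>"
    unfolding circle_weak_conv_def M_def
  proof (intro allI impI)
    fix f :: "complex \<Rightarrow> real" assume "continuous_on unit_circle f"
    then show "(\<lambda>n. LINT \<zeta>|foldl (\<uplus>\<^sub>\<times>) (circle_dirac (lam (Suc n))) (?row n). f \<zeta>)
        \<longlonglongrightarrow> (LINT \<zeta>|\<nu>. f \<zeta>)"
      by (intro LIMSEQ_Suc[OF assms(6)[unfolded circle_weak_conv_def, rule_format]])
  qed
  have "eventually (\<lambda>n. \<forall>z\<in>ball 0 r. B_fun (M n) z \<noteq> 0) sequentially" if r: "0 < r" "r < 1" for r
  proof -
    (* With both the distance threshold and the mass beyond it below this value, the mean distance to 1 is below 3 * \<epsilon>, less than the bound (1 - r)\<^sup>2 / 2 needed for absence of zeros. *)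
    define \<epsilon> where "\<epsilon> = (1 - r)\<^sup>2 / 8"
    have "\<epsilon> > 0" using r by (simp add: \<epsilon>_def)
    let ?m = "\<lambda>n j. measure (\<mu> n j) {\<zeta> \<in> unit_circle. cmod (\<zeta> - 1) \<ge> \<epsilon>}"
    have lim: "(\<lambda>n. Max (?m n ` {1..k n})) \<longlonglongrightarrow> 0"
      using assms(3) \<open>\<epsilon> > 0\<close> unfolding infinitesimal_array_def by blast
    have "eventually (\<lambda>n. Max (?m (Suc n) ` {1..k (Suc n)}) < \<epsilon>) sequentially"
      by (rule order_tendstoD(2)[OF LIMSEQ_Suc[OF lim] \<open>\<epsilon> > 0\<close>])
    then show ?thesis
    proof eventually_elim
      case (elim n)
      have nz: "B_fun (\<mu> (Suc n) j) z \<noteq> 0" if j: "j \<in> {1..k (Suc n)}" and z: "z \<in> ball 0 r" for j z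
      proof (rule B_fun_neq_0_near_dirac_1[OF \<mu>[OF j] _ r(2)])
        have "?m (Suc n) j \<le> Max (?m (Suc n) ` {1..k (Suc n)})"
          using j by (intro Max_ge) auto
        with elim have "?m (Suc n) j < \<epsilon>" by linarith
        then have "(LINT \<zeta>|\<mu> (Suc n) j. cmod (\<zeta> - 1)) < 4 * \<epsilon>"
          using integral_dist_1_le[OF \<mu>[OF j], of \<epsilon>] \<open>\<epsilon> > 0\<close> by linarith
        then show "(LINT \<zeta>|\<mu> (Suc n) j. cmod (\<zeta> - 1)) < (1 - r)\<^sup>2 / 2" by (simp add: \<epsilon>_def)
      qed (use z in auto)
      show ?case
      proof
        fix z :: complex assume z: "z \<in> ball 0 r"
        then have z1: "norm z < 1" using r by simp
        have "lam (Suc n) \<noteq> 0" using lam[of n] by auto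
        moreover have "(\<Prod>\<rho>\<leftarrow>?row n. B_fun \<rho> z) \<noteq> 0"
        proof
          assume "(\<Prod>\<rho>\<leftarrow>?row n. B_fun \<rho> z) = 0"
          then obtain j where "j \<in> set [1..<Suc (k (Suc n))]" "B_fun (\<mu> (Suc n) j) z = 0"
            unfolding prod_list_zero_iff set_map by (auto simp del: upt_Suc set_upt dest: sym)
          then show False using nz[OF _ z, of j] by (simp only: set_upt) simp
        qed
        ultimately show "B_fun (M n) z \<noteq> 0" unfolding B_M[OF z1] by (rule no_zero_divisors)
      qed
    qed
  qed
  then have "(\<forall>z\<in>ball 0 1. B_fun \<nu> z = 0) \<or> (\<forall>z\<in>ball 0 1. B_fun \<nu> z \<noteq> 0)"
    by (intro Hurwitz_disk_bounded[of "\<lambda>n. B_fun (M n)" 1] B_fun_holomorphic[OF M] norm_B_fun_le_1[OF M]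
          circle_weak_conv_imp_B_fun_tendsto[OF conv M assms(5)])
  then show ?thesis by (rule bool_inf_divisibleI[OF assms(5)])
qed

end
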